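(* Let $d\ge1$, and let $p:\mathbb{R}^d\to(0,\infty)$ be a probability density function (with respect to Lebesgue measure) such that $p(x)=\widetilde p(\|x\|^2)$ for all $x\in\mathbb{R}^d$, for some function $\widetilde p:[0,\infty)\to(0,\infty)$. Let $f:(0,\infty)\to\mathbb{R}$ be convex, with $f(1)=0$ and strictly convex at $1$. Then for densities $p_{\mu,\Sigma_1}$, $p_{\mu,\Sigma_2}$ of the location-scale family generated by $p$ with the same location, the $f$-divergence $I_f(p_{\mu,\Sigma_1}:p_{\mu,\Sigma_2})$ is a function of the eigenvalues of $\Sigma_1\Sigma_2^{-1}$. That is, there exists a function $E$ (depending only on $d$, $p$ and $f$), invariant under permutations of its $d$ arguments and with values in $[0,+\infty]$, such that for all $\mu\in\mathbb{R}^d$ and all symmetric positive-definite $d\times d$ real matrices $\Sigma_1,\Sigma_2$, $$I_f(p_{\mu,\Sigma_1}:p_{\mu,\Sigma_2})=E(\lambda_1,\ldots,\lambda_d),$$ where $\lambda_1,\ldots,\lambda_d$ are the eigenvalues of $\Sigma_1\Sigma_2^{-1}$ counted with multiplicity.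
   Context: $\|\cdot\|$ denotes the Euclidean norm on $\mathbb{R}^d$. For $\mu\in\mathbb{R}^d$ and a symmetric positive-definite $d\times d$ real matrix $\Sigma$, with $\Sigma^{1/2}$ its unique symmetric positive-definite square root and $\Sigma^{-1/2}$ the inverse of $\Sigma^{1/2}$, the density of the location-scale family generated by the standard density $p$ is $$p_{\mu,\Sigma}(x):=(\det\Sigma)^{-1/2}\,p\left(\Sigma^{-1/2}(x-\mu)\right),\quad x\in\mathbb{R}^d.$$ For a convex generator $f$ and positive probability densities $q_1,q_2$ on $\mathbb{R}^d$, the $f$-divergence is $$I_f(q_1:q_2):=\int_{\mathbb{R}^d}q_1(x)\,f\left(\frac{q_2(x)}{q_1(x)}\right)dx\in[0,+\infty].$$ (By convexity of $f$ and $f(1)=0$, the negative part of the integrand is integrable, so the integral is well defined, possibly $+\infty$.) *)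

theory Defs
  imports "HOL-Analysis.Analysis" "HOL-Computational_Algebra.Polynomial"
begin

definition pos_def_matrix :: "real^'n^'n \<Rightarrow> bool" where
  "pos_def_matrix A \<longleftrightarrow> transpose A = A \<and> (\<forall>x. x \<noteq> 0 \<longrightarrow> 0 < x \<bullet> (A *v x))"

definition matrix_sqrt :: "real^'n^'n \<Rightarrow> real^'n^'n" where
  "matrix_sqrt A = (THE B. pos_def_matrix B \<and> B ** B = A)"

definition location_scale_density ::
    "(real^'n \<Rightarrow> real) \<Rightarrow> real^'n \<Rightarrow> real^'n^'n \<Rightarrow> real^'n \<Rightarrow> real" where
  "location_scale_density p \<mu> \<Sigma> x =
     det \<Sigma> powr (-1/2) * p (matrix_inv (matrix_sqrt \<Sigma>) *v (x - \<mu>))"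

definition prob_density :: "(real^'n \<Rightarrow> real) \<Rightarrow> bool" where
  "prob_density p \<longleftrightarrow> p \<in> borel_measurable lebesgue \<and> (\<forall>x. 0 \<le> p x) \<and>
     (\<integral>\<^sup>+x. ennreal (p x) \<partial>lebesgue) = 1"

(* No nontrivial convex combination of points of S that equals c gives equality in
   the convexity inequality; s \<noteq> t and 0 < u < 1 force c to lie strictly between s and t. *)
definition strictly_convex_at :: "real set \<Rightarrow> (real \<Rightarrow> real) \<Rightarrow> real \<Rightarrow> bool" where
  "strictly_convex_at S f c \<longleftrightarrow>
     (\<forall>s\<in>S. \<forall>t\<in>S. \<forall>u\<in>{0<..<1}. s \<noteq> t \<longrightarrow> (1 - u) * s + u * t = c \<longrightarrow>
        f c < (1 - u) * f s + u * f t)"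

(* Lebesgue integral with extended real values, as positive part minus negative part:
   ennreal maps negative reals to 0.  Unlike the Bochner integral, it is infinite when
   only the positive part diverges. *)
definition extended_integral :: "'a measure \<Rightarrow> ('a \<Rightarrow> real) \<Rightarrow> ereal" where
  "extended_integral M g =
     enn2ereal (\<integral>\<^sup>+x. ennreal (g x) \<partial>M) - enn2ereal (\<integral>\<^sup>+x. ennreal (- g x) \<partial>M)"

definition f_divergence ::
    "(real \<Rightarrow> real) \<Rightarrow> (real^'n \<Rightarrow> real) \<Rightarrow> (real^'n \<Rightarrow> real) \<Rightarrow> ereal" where
  "f_divergence f q1 q2 = extended_integral lebesgue (\<lambda>x. q1 x * f (q2 x / q1 x))"

(* The subtraction in the f-divergence is never \<infinity> - \<infinity>. *)
lemma f_divergence_negative_part_finite: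
  fixes q1 q2 :: "real^'n \<Rightarrow> real"
  assumes f: "convex_on {0<..} f" "f 1 = 0"
    and q: "prob_density q1" "prob_density q2" "\<And>x. 0 < q1 x" "\<And>x. 0 < q2 x"
  shows "(\<integral>\<^sup>+x. ennreal (- (q1 x * f (q2 x / q1 x))) \<partial>lebesgue) < \<infinity>"
proof -
  have [measurable]: "q1 \<in> borel_measurable lebesgue" "q2 \<in> borel_measurable lebesgue"
    using q(1,2) by (auto simp: prob_density_def)
  define c where "c = Inf ((\<lambda>t. (f 1 - f t) / (1 - t)) ` ({1<..} \<inter> {0<..}))"
  have supp: "c * (t - 1) \<le> f t" if "0 < t" for t
    using convex_le_Inf_differential[OF f(1), of 1 t] that f(2)
    by (auto simp: c_def interior_open)
  have le: "- (q1 x * f (q2 x / q1 x)) \<le> \<bar>c\<bar> * (q1 x + q2 x)" for x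
  proof -
    have "q1 x * (c * (q2 x / q1 x - 1)) \<le> q1 x * f (q2 x / q1 x)"
      using supp[of "q2 x / q1 x"] q(3,4)[of x] by (intro mult_left_mono) auto
    moreover have "q1 x * (c * (q2 x / q1 x - 1)) = c * (q2 x - q1 x)"
      using q(3)[of x] by (simp add: field_simps)
    moreover have "\<bar>c * (q2 x - q1 x)\<bar> \<le> \<bar>c\<bar> * (q1 x + q2 x)"
      unfolding abs_mult using q(3,4)[of x] by (intro mult_left_mono) auto
    ultimately show ?thesis by linarith
  qed
  have "(\<integral>\<^sup>+x. ennreal (- (q1 x * f (q2 x / q1 x))) \<partial>lebesgue)
      \<le> (\<integral>\<^sup>+x. ennreal \<bar>c\<bar> * (ennreal (q1 x) + ennreal (q2 x)) \<partial>lebesgue)"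
  proof (rule nn_integral_mono)
    fix x
    have "ennreal \<bar>c\<bar> * (ennreal (q1 x) + ennreal (q2 x)) = ennreal (\<bar>c\<bar> * (q1 x + q2 x))"
      using q(3,4)[of x] by (simp add: ennreal_mult ennreal_plus[symmetric] del: ennreal_plus)
    then show "ennreal (- (q1 x * f (q2 x / q1 x)))
        \<le> ennreal \<bar>c\<bar> * (ennreal (q1 x) + ennreal (q2 x))"
      using le[of x] by (simp add: ennreal_leI)
  qed
  also have "\<dots> = ennreal \<bar>c\<bar> * (1 + 1)"
    using q(1,2) by (subst nn_integral_cmult) (auto simp: nn_integral_add prob_density_def)
  also have "\<dots> < \<infinity>"
    by (simp add: ennreal_mult_less_top)
  finally show ?thesis .
qed

(* det (X I - A), computed over the polynomial ring *)
definition char_polynomial :: "'a::comm_ring_1^'n^'n \<Rightarrow> 'a poly" where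
  "char_polynomial A = det (mat [:0, 1:] - map_matrix (\<lambda>a. [:a:]) A)"

lemma poly_char_polynomial: "poly (char_polynomial A) x = det (mat x - A)"
  unfolding char_polynomial_def det_def
  by (auto simp: poly_sum poly_prod mat_def intro!: sum.cong prod.cong arg_cong2[where f = "(*)"])

lemma poly_char_polynomial_eq_0_iff:
  fixes A :: "real^'n^'n"
  shows "poly (char_polynomial A) x = 0 \<longleftrightarrow> (\<exists>v. v \<noteq> 0 \<and> A *v v = x *\<^sub>R v)"
proof -
  have "(mat x - A) *v v = x *\<^sub>R v - A *v v" for v
    by (simp add: vec_eq_iff matrix_vector_mult_def mat_def left_diff_distrib sum_subtractf
        if_distrib[where f = "\<lambda>a. a * _"] cong: if_cong)
  then show ?thesis
    unfolding poly_char_polynomial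
    using invertible_det_nz[of "mat x - A"] matrix_left_invertible_ker[of "mat x - A"]
    by (auto simp: invertible_left_inverse)
qed

(* The components of l list the eigenvalues of A with algebraic multiplicity. *)
definition eigenvalue_listing :: "real^'n^'n \<Rightarrow> real^'n \<Rightarrow> bool" where
  "eigenvalue_listing A l \<longleftrightarrow>
     image_mset (\<lambda>i. l $ i) (mset_set UNIV) = proots (char_polynomial A)"

end

theory Submission
  imports Defs
begin

text \<open>
  An f-divergence does not change when both densities are transformed by the same affine map.
  Applying \<open>x = \<mu> + \<Sigma>1\<^sup>1\<^sup>/\<^sup>2 y\<close> removes the location and the first scale: the first density becomes
  \<open>p\<close> and the second becomes \<open>y \<mapsto> \<bar>det A\<bar> p(A y)\<close> with \<open>A = \<Sigma>2\<^sup>-\<^sup>1\<^sup>/\<^sup>2 \<Sigma>1\<^sup>1\<^sup>/\<^sup>2\<close>. As \<open>p\<close> depends on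
  the norm only, \<open>p(A y)\<close> depends on \<open>A\<close> only through \<open>A\<^sup>T A = \<Sigma>1\<^sup>1\<^sup>/\<^sup>2 \<Sigma>2\<^sup>-\<^sup>1 \<Sigma>1\<^sup>1\<^sup>/\<^sup>2\<close>, which is symmetric,
  positive definite and similar to \<open>\<Sigma>1 \<Sigma>2\<^sup>-\<^sup>1\<close>. A rotation to an eigenbasis of this matrix fixes
  \<open>p\<close> and turns \<open>A\<close> into the diagonal stretch by the square roots of the eigenvalues
  (\<open>f_divergence_location_scale_eq_stretch\<close>). So the divergence is an explicit integral in the
  eigenvalues. It is symmetric in them because coordinate permutations are orthogonal
  (\<open>stretch_divergence_permute\<close>), and nonnegative by Jensen's inequality
  (\<open>f_divergence_nonneg\<close>). Two listings of the eigenvalues of one matrix differ by a permutation,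
  so the choice of a listing is immaterial.

  The ingredients are the spectral theorem (\<open>symmetric_matrix_diagonalization\<close>), which also yields
  existence and uniqueness of the positive definite square root, and the behaviour of Lebesgue
  measure under orthogonal maps (\<open>lborel_distr_orthogonal_transformation\<close>) and under coordinatewise
  stretches with a translation. A positive definite matrix is a stretch between two rotations, so these two cases
  cover every change of variables that occurs.
\<close>

section \<open>Affine changes of variables for Lebesgue measure\<close>

lemma nn_integral_lborel_translate_reflect:
  fixes g :: "'a::euclidean_space \<Rightarrow> ennreal"
  assumes [measurable]: "g \<in> borel_measurable borel"
  shows "(\<integral>\<^sup>+x. g (a + x) \<partial>lborel) = (\<integral>\<^sup>+x. g x \<partial>lborel)"
    and "(\<integral>\<^sup>+x. g (a - x) \<partial>lborel) = (\<integral>\<^sup>+x. g x \<partial>lborel)"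
proof -
  have "(\<integral>\<^sup>+x. g x \<partial>lborel) = (\<integral>\<^sup>+x. g (a + c *\<^sub>R x) \<partial>lborel)" if "\<bar>c\<bar> = 1" for c
  proof -
    have "c \<noteq> 0" using that by auto
    then show ?thesis
      by (subst lborel_affine[of c a])
         (simp_all add: nn_integral_density nn_integral_distr that)
  qed
  from this[of 1] this[of "-1"]
  show "(\<integral>\<^sup>+x. g (a + x) \<partial>lborel) = (\<integral>\<^sup>+x. g x \<partial>lborel)"
    and "(\<integral>\<^sup>+x. g (a - x) \<partial>lborel) = (\<integral>\<^sup>+x. g x \<partial>lborel)"
    by simp_all
qed

text \<open>
  A translation invariant measure is determined up to a factor by Lebesgue measure \<open>\<lambda>\<close>.
  Here this appears as a double integral: translating \<open>y\<close> by \<open>T x\<close>, exchanging the order of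
  integration and translating \<open>x\<close> back shows
  \<open>\<lambda>(T\<^sup>-\<^sup>1 A) \<lambda>(B) = \<lambda>(A) \<lambda>(T\<^sup>-\<^sup>1 B)\<close> for all Borel sets \<open>A\<close>, \<open>B\<close>.
  The unit ball \<open>B\<close> is its own preimage under an isometry fixing the origin and has positive finite
  measure, so it cancels.\<close>

lemma lborel_distr_orthogonal_transformation:
  fixes T :: "'a::euclidean_space \<Rightarrow> 'a"
  assumes "orthogonal_transformation T"
  shows "distr lborel borel T = lborel"
proof (rule measure_eqI)
  have lin: "linear T" and nT: "norm (T x) = norm x" for x
    using assms by (auto simp: orthogonal_transformation)
  have T[measurable]: "T \<in> borel_measurable borel"
    using lin by (intro borel_measurable_continuous_onI linear_continuous_on)
      (simp add: linear_conv_bounded_linear)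
  have bij: "bij T" using assms by (rule orthogonal_transformation_bij)
  define U where "U = inv T"
  have TU: "T (U y) = y" for y using bij by (simp add: U_def bij_is_surj surj_f_inv_f)
  fix A assume "A \<in> sets (distr lborel borel T)"
  then have A[measurable]: "A \<in> sets borel" by simp
  define B where "B = ball (0::'a) 1"
  have B[measurable]: "B \<in> sets borel" by (simp add: B_def)
  have indB: "indicator B (T x) = (indicator B x :: ennreal)" for x
    by (simp add: B_def indicator_def nT)
  let ?TA = "\<integral>\<^sup>+x. indicator A (T x) \<partial>lborel"
  have "?TA * emeasure lborel B
      = (\<integral>\<^sup>+x. indicator A (T x) * (\<integral>\<^sup>+y. indicator B y \<partial>lborel) \<partial>lborel)"
    by (simp add: nn_integral_multc)
  also have "\<dots> = (\<integral>\<^sup>+x. indicator A (T x) * (\<integral>\<^sup>+y. indicator B (T x + y) \<partial>lborel) \<partial>lborel)"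
    by (simp add: nn_integral_lborel_translate_reflect(1))
  also have "\<dots> = (\<integral>\<^sup>+x. (\<integral>\<^sup>+y. indicator A (T x) * indicator B (T x + y) \<partial>lborel) \<partial>lborel)"
    by (simp add: nn_integral_cmult)
  also have "\<dots> = (\<integral>\<^sup>+y. (\<integral>\<^sup>+x. indicator A (T x) * indicator B (T x + y) \<partial>lborel) \<partial>lborel)"
    by (rule lborel_pair.Fubini'[symmetric]) simp
  \<comment> \<open>replace \<open>x\<close> by \<open>x - U y\<close>\<close>
  also have "\<dots> = (\<integral>\<^sup>+y. (\<integral>\<^sup>+x. indicator A (T x - y) * indicator B (T x) \<partial>lborel) \<partial>lborel)"
  proof (rule nn_integral_cong)
    fix y
    have "(\<integral>\<^sup>+x. indicator A (T (- U y + x)) * indicator B (T (- U y + x) + y) \<partial>lborel)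
       = (\<integral>\<^sup>+x. indicator A (T x) * indicator B (T x + y) \<partial>(lborel::'a measure) :: ennreal)"
      by (rule nn_integral_lborel_translate_reflect(1)) simp
    moreover have "T (- U y + x) = T x - y" for x
      by (simp only: linear_add[OF lin] linear_neg[OF lin] TU) simp
    ultimately show "(\<integral>\<^sup>+x. indicator A (T x) * indicator B (T x + y) \<partial>(lborel::'a measure) :: ennreal)
        = (\<integral>\<^sup>+x. indicator A (T x - y) * indicator B (T x) \<partial>lborel)"
      by simp
  qed
  also have "\<dots> = (\<integral>\<^sup>+x. (\<integral>\<^sup>+y. indicator A (T x - y) * indicator B (T x) \<partial>lborel) \<partial>lborel)"
    by (rule lborel_pair.Fubini') simp
  also have "\<dots> = (\<integral>\<^sup>+x. emeasure lborel A * indicator B (T x) \<partial>lborel)"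
    by (simp add: nn_integral_multc nn_integral_lborel_translate_reflect(2))
  also have "\<dots> = emeasure lborel A * emeasure lborel B"
    by (simp add: nn_integral_cmult indB)
  finally have eq: "?TA * emeasure lborel B = emeasure lborel A * emeasure lborel B" .
  have "emeasure lborel B \<noteq> top"
    unfolding B_def using emeasure_bounded_finite[of "ball (0::'a) 1"] by auto
  moreover have "emeasure lborel B \<noteq> 0"
    unfolding B_def using content_ball_pos[of 1 "0::'a"] by (auto simp: measure_def)
  ultimately have "?TA = emeasure lborel A"
    using eq by (metis ennreal_mult_divide_eq mult.commute)
  moreover have "?TA = emeasure (distr lborel borel T) A"
    using nn_integral_distr[of T lborel borel "indicator A"] by simp
  ultimately show "emeasure (distr lborel borel T) A = emeasure lborel A" by simp
qed simp

text \<open>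
  The map \<open>T\<close> has constant Jacobian \<open>c\<close>. The condition concerns the completed measure because
  the densities are Lebesgue measurable only, and such functions need not stay measurable
  under composition with Borel maps.\<close>

definition scales_lebesgue :: "('a::euclidean_space \<Rightarrow> 'a) \<Rightarrow> real \<Rightarrow> bool" where
  "scales_lebesgue T c \<longleftrightarrow> 0 < c \<and> T \<in> lebesgue \<rightarrow>\<^sub>M lebesgue \<and>
     lebesgue = density (distr lebesgue lebesgue T) (\<lambda>_. ennreal c)"

lemma scales_lebesgue_nn_integral:
  assumes T: "scales_lebesgue T c" and [measurable]: "g \<in> borel_measurable lebesgue"
  shows "(\<integral>\<^sup>+x. g x \<partial>lebesgue) = ennreal c * (\<integral>\<^sup>+x. g (T x) \<partial>lebesgue)"
proof -
  have [measurable]: "T \<in> lebesgue \<rightarrow>\<^sub>M lebesgue"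
    and eq: "lebesgue = density (distr lebesgue lebesgue T) (\<lambda>_. ennreal c)"
    using T by (auto simp: scales_lebesgue_def)
  have "(\<integral>\<^sup>+x. g x \<partial>lebesgue) = (\<integral>\<^sup>+x. ennreal c * g x \<partial>distr lebesgue lebesgue T)"
    by (subst eq, subst nn_integral_density) auto
  also have "\<dots> = (\<integral>\<^sup>+x. ennreal c * g (T x) \<partial>lebesgue)"
    by (subst nn_integral_distr) auto
  also have "\<dots> = ennreal c * (\<integral>\<^sup>+x. g (T x) \<partial>lebesgue)"
    by (intro nn_integral_cmult) (rule measurable_compose[of T _ lebesgue]; simp)
  finally show ?thesis .
qed

lemma scales_lebesgue_comp:
  assumes T: "scales_lebesgue T c" and U: "scales_lebesgue U d"
  shows "scales_lebesgue (\<lambda>x. T (U x)) (c * d)"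
proof -
  have Tm: "T \<in> lebesgue \<rightarrow>\<^sub>M lebesgue" and Um: "U \<in> lebesgue \<rightarrow>\<^sub>M lebesgue" and pos: "0 < c" "0 < d"
    using T U by (auto simp: scales_lebesgue_def)
  have TU: "(\<lambda>x. T (U x)) \<in> lebesgue \<rightarrow>\<^sub>M lebesgue"
    by (rule measurable_compose[OF Um Tm])
  have "lebesgue = density (distr lebesgue lebesgue (\<lambda>x. T (U x))) (\<lambda>_. ennreal (c * d))"
  proof (rule measure_eqI)
    fix A :: "'a set" assume A: "A \<in> sets lebesgue"
    have [measurable]: "(\<lambda>x. indicator A (T x) :: ennreal) \<in> borel_measurable lebesgue"
      by (rule measurable_compose[OF Tm]) (use A in simp)
    have "emeasure lebesgue A = ennreal c * (ennreal d * (\<integral>\<^sup>+x. indicator A (T (U x)) \<partial>lebesgue))"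
      using scales_lebesgue_nn_integral[OF T, of "indicator A"]
        scales_lebesgue_nn_integral[OF U, of "\<lambda>x. indicator A (T x)"] A by simp
    also have "(\<integral>\<^sup>+x. indicator A (T (U x)) \<partial>lebesgue) = emeasure (distr lebesgue lebesgue (\<lambda>x. T (U x))) A"
      using nn_integral_distr[OF TU, of "indicator A"] A by simp
    also have "ennreal c * (ennreal d * \<dots>)
        = emeasure (density (distr lebesgue lebesgue (\<lambda>x. T (U x))) (\<lambda>_. ennreal (c * d))) A"
      using A pos TU by (simp add: emeasure_density nn_integral_cmult ennreal_mult mult.assoc)
    finally show "emeasure lebesgue A = \<dots>" .
  qed simp
  with TU pos show ?thesis by (simp add: scales_lebesgue_def)
qed

text \<open>
  The push-forward of \<open>lborel\<close> is \<open>lborel\<close> itself, so \<open>T\<close> pulls null sets back to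
  null sets; this lets both measurability and the push-forward identity pass to the completion.\<close>

lemma scales_lebesgue_orthogonal:
  fixes T :: "'a::euclidean_space \<Rightarrow> 'a"
  assumes "orthogonal_transformation T"
  shows "scales_lebesgue T 1"
proof -
  note eq = lborel_distr_orthogonal_transformation[OF assms]
  have "linear T" using assms by (rule orthogonal_transformation_linear)
  then have T[measurable]: "T \<in> borel_measurable borel"
    by (intro borel_measurable_continuous_onI linear_continuous_on)
      (simp add: linear_conv_bounded_linear)
  have eq': "distr lebesgue lborel T = lborel"
    using eq by (simp add: distr_completion cong: distr_cong)
  have Tm: "T \<in> lebesgue \<rightarrow>\<^sub>M lebesgue"
    by (simp add: completion.measurable_completion2 eq' measurable_completion)
  have "distr lebesgue lebesgue T = completion (distr lebesgue lborel T)"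
    by (subst completion.completion_distr_eq) (auto simp: eq' measurable_completion)
  then have "lebesgue = distr lebesgue lebesgue T" by (simp add: eq')
  then show ?thesis using Tm by (simp add: scales_lebesgue_def density_1)
qed

lemma scales_lebesgue_translation_diagonal:
  fixes t c :: "real^'n"
  assumes c: "\<And>i. 0 < c $ i"
  shows "scales_lebesgue (\<lambda>x. t + (\<chi> i. c $ i * x $ i)) (\<Prod>i\<in>UNIV. c $ i)"
proof -
  have inj: "inj (\<lambda>i::'n. axis i (1::real))" by (auto simp: inj_def axis_eq_axis)
  have Basis: "(Basis :: (real^'n) set) = range (\<lambda>i. axis i 1)" by (auto simp: Basis_vec_def)
  have "t + (\<Sum>j\<in>Basis. ((c \<bullet> j) * (x \<bullet> j)) *\<^sub>R j) = t + (\<chi> i. c $ i * x $ i)" for x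
    by (subst euclidean_representation[symmetric, of "\<chi> i. c $ i * x $ i"])
      (auto simp: Basis inner_axis intro!: sum.cong)
  moreover have "(\<Prod>j\<in>Basis. \<bar>c \<bullet> j\<bar>) = (\<Prod>i\<in>UNIV. c $ i)"
    unfolding Basis by (subst prod.reindex[OF inj]) (use c in \<open>simp add: inner_axis abs_of_pos\<close>)
  moreover have "c \<bullet> j \<noteq> 0" if "j \<in> Basis" for j
    using that c by (auto simp: Basis inner_axis less_imp_neq[symmetric])
  moreover have "0 < (\<Prod>i\<in>UNIV. c $ i)" using c by (simp add: prod_pos)
  ultimately show ?thesis
    using lebesgue_affine_euclidean[of "\<lambda>j. c \<bullet> j" t] lebesgue_affine_measurable[of "\<lambda>j. c \<bullet> j" t]
    by (simp add: scales_lebesgue_def prod_ennreal)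
qed

section \<open>Change of variables and nonnegativity for f-divergences\<close>

lemma measurable_lebesgue_f_divergence_integrand:
  assumes f: "convex_on {0<..} f"
    and [measurable]: "q1 \<in> borel_measurable M" "q2 \<in> borel_measurable M"
    and pos: "\<And>x. 0 < q1 x" "\<And>x. 0 < (q2 x :: real)"
  shows "(\<lambda>x. q1 x * f (q2 x / q1 x)) \<in> borel_measurable M"
proof -
  have "continuous_on {0<..} f" by (rule convex_on_continuous[OF open_greaterThan f])
  then have fm: "(\<lambda>t. indicator {0<..} t *\<^sub>R f t) \<in> borel_measurable borel"
    by (intro borel_measurable_continuous_on_indicator) auto
  have ratio: "(\<lambda>x. q2 x / q1 x) \<in> borel_measurable M" by measurable
  have [measurable]: "(\<lambda>x. indicator {0<..} (q2 x / q1 x) *\<^sub>R f (q2 x / q1 x)) \<in> borel_measurable M"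
    by (rule measurable_compose[OF ratio fm])
  have "(\<lambda>x. q1 x * (indicator {0<..} (q2 x / q1 x) *\<^sub>R f (q2 x / q1 x))) \<in> borel_measurable M"
    by measurable
  then show ?thesis using pos by (simp add: indicator_def)
qed

text \<open>
  The ratio of the two densities is unaffected by a common Jacobian factor, so the integrand for
  the transformed densities is the transformed integrand.\<close>

lemma f_divergence_scales_lebesgue:
  fixes q1 q2 :: "real^'n \<Rightarrow> real"
  assumes f: "convex_on {0<..} f"
    and T: "scales_lebesgue T c"
    and q: "q1 \<in> borel_measurable lebesgue" "q2 \<in> borel_measurable lebesgue"
    and pos: "\<And>x. 0 < q1 x" "\<And>x. 0 < q2 x"
  shows "f_divergence f q1 q2 = f_divergence f (\<lambda>x. c * q1 (T x)) (\<lambda>x. c * q2 (T x))"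
proof -
  have c: "0 < c" and Tm: "T \<in> lebesgue \<rightarrow>\<^sub>M lebesgue" using T by (auto simp: scales_lebesgue_def)
  let ?h = "\<lambda>x. q1 x * f (q2 x / q1 x)"
  have h: "?h \<in> borel_measurable lebesgue"
    by (rule measurable_lebesgue_f_divergence_integrand[OF f q pos])
  have eq: "(\<integral>\<^sup>+x. ennreal (s * ?h x) \<partial>lebesgue) = (\<integral>\<^sup>+x. ennreal (s * (c * ?h (T x))) \<partial>lebesgue)" for s
  proof -
    have m: "(\<lambda>x. ennreal (s * ?h x)) \<in> borel_measurable lebesgue" using h by measurable
    have "(\<integral>\<^sup>+x. ennreal (s * ?h x) \<partial>lebesgue) = ennreal c * (\<integral>\<^sup>+x. ennreal (s * ?h (T x)) \<partial>lebesgue)"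
      by (rule scales_lebesgue_nn_integral[OF T m])
    also have "\<dots> = (\<integral>\<^sup>+x. ennreal c * ennreal (s * ?h (T x)) \<partial>lebesgue)"
      by (rule nn_integral_cmult[symmetric]) (rule measurable_compose[OF Tm m])
    also have "\<dots> = (\<integral>\<^sup>+x. ennreal (s * (c * ?h (T x))) \<partial>lebesgue)"
      using c by (simp add: ennreal_mult'[symmetric] mult.left_commute)
    finally show ?thesis .
  qed
  show ?thesis
    unfolding f_divergence_def extended_integral_def
    using eq[of 1] eq[of "-1"] c by (simp add: mult.assoc)
qed

text \<open>
  Jensen's inequality for possibly non-integrable integrands. A supporting line of \<open>f\<close> at \<open>1\<close>
  bounds the integrand from below by \<open>c * (q2 - q1)\<close>, which has integral \<open>0\<close>. The slope is
  split as \<open>c = a - b\<close> with \<open>a, b \<ge> 0\<close>, so that the bound can be rearranged into an inequality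
  between sums of nonnegative functions, where integrals may be infinite.\<close>

lemma f_divergence_nonneg:
  fixes q1 q2 :: "real^'n \<Rightarrow> real"
  assumes f: "convex_on {0<..} f" "f 1 = 0"
    and q: "prob_density q1" "prob_density q2" and pos: "\<And>x. 0 < q1 x" "\<And>x. 0 < q2 x"
  shows "0 \<le> f_divergence f q1 q2"
proof -
  have qm[measurable]: "q1 \<in> borel_measurable lebesgue" "q2 \<in> borel_measurable lebesgue"
    and int: "(\<integral>\<^sup>+x. ennreal (q1 x) \<partial>lebesgue) = 1" "(\<integral>\<^sup>+x. ennreal (q2 x) \<partial>lebesgue) = 1"
    using q by (auto simp: prob_density_def)
  let ?h = "\<lambda>x. q1 x * f (q2 x / q1 x)"
  have [measurable]: "?h \<in> borel_measurable lebesgue"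
    by (rule measurable_lebesgue_f_divergence_integrand[OF f(1) qm pos])
  \<comment> \<open>the right derivative of \<open>f\<close> at \<open>1\<close>\<close>
  define c where "c = Inf ((\<lambda>t. (f 1 - f t) / (1 - t)) ` ({1<..} \<inter> {0<..}))"
  have supp: "c * (t - 1) \<le> f t" if "0 < t" for t
    using convex_le_Inf_differential[OF f(1), of 1 t] that f(2)
    by (auto simp: c_def interior_open)
  define a b where "a = max c 0" and "b = max (- c) 0"
  have ab: "0 \<le> a" "0 \<le> b" "c = a - b" by (auto simp: a_def b_def)
  have tangent: "c * (q2 x - q1 x) \<le> ?h x" for x
  proof -
    have "q1 x * (c * (q2 x / q1 x - 1)) \<le> ?h x"
      using supp[of "q2 x / q1 x"] pos[of x] by (intro mult_left_mono) auto
    moreover have "q1 x * (c * (q2 x / q1 x - 1)) = c * (q2 x - q1 x)"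
      using pos(1)[of x] by (simp add: field_simps)
    ultimately show ?thesis by simp
  qed
  have lin: "(\<integral>\<^sup>+x. ennreal (r * q1 x + s * q2 x) \<partial>lebesgue) = ennreal (r + s)"
    if "0 \<le> r" "0 \<le> s" for r s
  proof -
    have "(\<integral>\<^sup>+x. ennreal (r * q1 x + s * q2 x) \<partial>lebesgue)
        = (\<integral>\<^sup>+x. ennreal r * ennreal (q1 x) + ennreal s * ennreal (q2 x) \<partial>lebesgue)"
      using that pos by (simp add: ennreal_mult less_imp_le)
    also have "\<dots> = ennreal r + ennreal s"
      by (simp add: nn_integral_add nn_integral_cmult int)
    finally show ?thesis using that by simp
  qed
  have balance: "ennreal (- t) + ennreal u \<le> ennreal t + ennreal v"
    if "0 \<le> u" "0 \<le> v" "u - v \<le> t" for t u v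
  proof (cases "0 \<le> t")
    case True
    then have "ennreal (- t) + ennreal u = ennreal u" by (simp add: ennreal_neg)
    also have "\<dots> \<le> ennreal (t + v)" using that by (intro ennreal_leI) simp
    also have "\<dots> = ennreal t + ennreal v" using True that by (intro ennreal_plus)
    finally show ?thesis .
  next
    case False
    then have "ennreal (- t) + ennreal u = ennreal (- t + u)" using that by (intro ennreal_plus[symmetric]) auto
    also have "\<dots> \<le> ennreal v" using that by (intro ennreal_leI) simp
    also have "\<dots> = ennreal t + ennreal v" using False by (simp add: ennreal_neg)
    finally show ?thesis .
  qed
  define u where "u x = b * q1 x + a * q2 x" for x
  define v where "v x = a * q1 x + b * q2 x" for x
  have [measurable]: "u \<in> borel_measurable lebesgue" "v \<in> borel_measurable lebesgue"
    unfolding u_def v_def by measurable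
  have "(\<integral>\<^sup>+x. ennreal (u x) \<partial>lebesgue) = ennreal (b + a)" "(\<integral>\<^sup>+x. ennreal (v x) \<partial>lebesgue) = ennreal (b + a)"
    using lin[of b a] lin[of a b] ab by (simp_all add: u_def v_def add.commute)
  note int_uv = this
  have "(\<integral>\<^sup>+x. ennreal (- ?h x) \<partial>lebesgue) + ennreal (b + a)
      = (\<integral>\<^sup>+x. ennreal (- ?h x) + ennreal (u x) \<partial>lebesgue)"
    unfolding int_uv(1)[symmetric] by (intro nn_integral_add[symmetric]) measurable
  also have "\<dots> \<le> (\<integral>\<^sup>+x. ennreal (?h x) + ennreal (v x) \<partial>lebesgue)"
  proof (intro nn_integral_mono balance)
    fix x
    show "0 \<le> u x" "0 \<le> v x" using ab pos[of x] by (simp_all add: u_def v_def)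
    show "u x - v x \<le> ?h x"
      using tangent[of x] by (simp add: u_def v_def ab(3) left_diff_distrib right_diff_distrib)
  qed
  also have "\<dots> = (\<integral>\<^sup>+x. ennreal (?h x) \<partial>lebesgue) + ennreal (b + a)"
    unfolding int_uv(2)[symmetric] by (intro nn_integral_add) measurable
  finally have le: "(\<integral>\<^sup>+x. ennreal (- ?h x) \<partial>lebesgue) \<le> (\<integral>\<^sup>+x. ennreal (?h x) \<partial>lebesgue)"
    by (simp add: ennreal_add_left_cancel_le add.commute)
  have fin: "(\<integral>\<^sup>+x. ennreal (- ?h x) \<partial>lebesgue) \<noteq> \<infinity>"
    using f_divergence_negative_part_finite[OF f q pos] by auto
  show ?thesis
    unfolding f_divergence_def extended_integral_def
    using le fin by (simp add: ereal_diff_positive less_eq_ennreal.rep_eq)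
qed

lemma prob_density_scales_lebesgue:
  fixes p :: "real^'n \<Rightarrow> real"
  assumes T: "scales_lebesgue T c" and p: "prob_density p"
  shows "prob_density (\<lambda>x. c * p (T x))"
proof -
  have c: "0 < c" and Tm: "T \<in> lebesgue \<rightarrow>\<^sub>M lebesgue" using T by (auto simp: scales_lebesgue_def)
  have pm: "p \<in> borel_measurable lebesgue" and p0: "\<And>x. 0 \<le> p x"
    and int: "(\<integral>\<^sup>+x. ennreal (p x) \<partial>lebesgue) = 1"
    using p by (auto simp: prob_density_def)
  have pTm[measurable]: "(\<lambda>x. p (T x)) \<in> borel_measurable lebesgue" by (rule measurable_compose[OF Tm pm])
  have "(\<integral>\<^sup>+x. ennreal (c * p (T x)) \<partial>lebesgue) = ennreal c * (\<integral>\<^sup>+x. ennreal (p (T x)) \<partial>lebesgue)"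
    using c p0 by (simp add: ennreal_mult nn_integral_cmult)
  also have "\<dots> = 1"
    using scales_lebesgue_nn_integral[OF T, of "\<lambda>x. ennreal (p x)"] pm int by simp
  finally show ?thesis using c p0 by (simp add: prob_density_def)
qed

section \<open>The spectral theorem for symmetric real matrices\<close>

lemma symmetric_matrix_inner:
  fixes A :: "real^'n^'n"
  assumes "transpose A = A"
  shows "x \<bullet> (A *v y) = (A *v x) \<bullet> y"
  by (metis assms dot_lmul_matrix vector_transpose_matrix)

text \<open>
  A maximiser \<open>v\<close> of the Rayleigh quotient on the unit sphere of \<open>S\<close> is an eigenvector. With
  the maximum \<open>c\<close>, the form \<open>c * (x \<bullet> x) - x \<bullet> (A *v x)\<close> is nonnegative on \<open>S\<close> and vanishes
  at \<open>v\<close>, so its derivative at \<open>v\<close> in the direction of the residual \<open>u = c *\<^sub>R v - A *v v\<close>,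
  which is \<open>2 * (u \<bullet> u)\<close>, must be zero.\<close>

lemma symmetric_matrix_eigenvector_in_subspace:
  fixes A :: "real^'n^'n"
  assumes sym: "transpose A = A" and S: "subspace S" and inv: "\<And>x. x \<in> S \<Longrightarrow> A *v x \<in> S"
    and nz: "S \<noteq> {0}"
  obtains v c where "v \<in> S" "norm v = 1" "A *v v = c *\<^sub>R v"
proof -
  let ?K = "S \<inter> sphere 0 1"
  obtain w where w: "w \<in> S" "w \<noteq> 0" using nz subspace_0[OF S] by auto
  then have "(1 / norm w) *\<^sub>R w \<in> ?K" by (auto intro: subspace_scale[OF S])
  then have ne: "?K \<noteq> {}" by blast
  have cpt: "compact ?K" by (intro closed_Int_compact closed_subspace S) auto
  have cont: "continuous_on ?K (\<lambda>x. x \<bullet> (A *v x))"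
    by (intro continuous_intros)
  obtain v where v: "v \<in> ?K" and max: "\<And>x. x \<in> ?K \<Longrightarrow> x \<bullet> (A *v x) \<le> v \<bullet> (A *v v)"
    using continuous_attains_sup[OF cpt ne cont] by blast
  define c where "c = v \<bullet> (A *v v)"
  have vS: "v \<in> S" and nv: "norm v = 1" using v by auto
  have vv: "v \<bullet> v = 1" using nv by (simp add: norm_eq_1)
  have quad: "x \<bullet> (A *v x) \<le> c * (x \<bullet> x)" if "x \<in> S" for x
  proof (cases "x = 0")
    case False
    then have "(1 / norm x) *\<^sub>R x \<in> ?K" using that by (auto intro: subspace_scale[OF S])
    from max[OF this] have "(x \<bullet> (A *v x)) / (norm x)\<^sup>2 \<le> c"
      by (simp add: c_def matrix_vector_mult_scaleR power2_eq_square)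
    with False show ?thesis by (simp add: divide_le_eq power2_norm_eq_inner)
  qed simp
  define u where "u = c *\<^sub>R v - A *v v"
  have uS: "u \<in> S" unfolding u_def by (intro subspace_diff subspace_scale S vS inv)
  define h where "h = c * (u \<bullet> u) - u \<bullet> (A *v u)"
  \<comment> \<open>the form \<open>c \<parallel>x\<parallel>\<^sup>2 - x \<bullet> A x\<close> at \<open>v + t u\<close>, a quadratic in \<open>t\<close> vanishing at \<open>0\<close>\<close>
  have "0 \<le> 2 * t * (u \<bullet> u) + t\<^sup>2 * h" for t
  proof -
    have "v + t *\<^sub>R u \<in> S" by (intro subspace_add subspace_scale S vS uS)
    from quad[OF this]
    have "0 \<le> c * ((v + t *\<^sub>R u) \<bullet> (v + t *\<^sub>R u)) - (v + t *\<^sub>R u) \<bullet> (A *v (v + t *\<^sub>R u))" by simp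
    also have "\<dots> = c * (v \<bullet> v) - c + 2 * t * (c * (v \<bullet> u) - u \<bullet> (A *v v)) + t\<^sup>2 * h"
    proof -
      have "v \<bullet> (A *v u) = u \<bullet> (A *v v)" "u \<bullet> v = v \<bullet> u"
        using symmetric_matrix_inner[OF sym, of v u] by (simp_all add: inner_commute)
      then show ?thesis
        unfolding h_def c_def matrix_vector_right_distrib matrix_vector_mult_scaleR inner_add_left
          inner_add_right inner_scaleR_left inner_scaleR_right power2_eq_square
        by (simp only:) (simp add: algebra_simps)
    qed
    also have "c * (v \<bullet> u) - u \<bullet> (A *v v) = u \<bullet> u"
      by (subst (3) u_def) (simp add: inner_diff_right inner_commute)
    finally show ?thesis by (simp add: vv)
  qed
  note nonneg = this
  have "u = 0"
  proof (rule ccontr)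
    assume "u \<noteq> 0"
    then have pos: "0 < u \<bullet> u" by simp
    \<comment> \<open>a step against the slope, short enough for the linear term to dominate \<open>t\<^sup>2 * h\<close>\<close>
    define t where "t = - (u \<bullet> u) / (\<bar>h\<bar> + 1)"
    have t: "t < 0" "\<bar>t\<bar> * (\<bar>h\<bar> + 1) = u \<bullet> u"
      using pos by (simp_all add: t_def divide_neg_pos abs_divide)
    have "t\<^sup>2 * h \<le> \<bar>t\<bar> * (\<bar>t\<bar> * (\<bar>h\<bar> + 1))"
      by (simp add: power2_eq_square mult.assoc[symmetric] mult_left_mono)
    then have "t\<^sup>2 * h \<le> \<bar>t\<bar> * (u \<bullet> u)" by (simp only: t)
    moreover have "2 * t * (u \<bullet> u) = - (2 * (\<bar>t\<bar> * (u \<bullet> u)))" using t(1) by simp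
    moreover have "0 < \<bar>t\<bar> * (u \<bullet> u)" using t(1) pos by (intro mult_pos_pos) auto
    ultimately show False using nonneg[of t] by linarith
  qed
  then have "A *v v = c *\<^sub>R v" by (simp add: u_def)
  with vS nv that show ?thesis by blast
qed

text \<open>
  Splitting off an eigenvector leaves its orthogonal complement in \<open>S\<close>, which is invariant because
  \<open>A\<close> is symmetric and has smaller dimension.\<close>

lemma symmetric_matrix_eigenbasis_subspace:
  fixes A :: "real^'n^'n"
  assumes sym: "transpose A = A"
  shows "subspace S \<Longrightarrow> (\<And>x. x \<in> S \<Longrightarrow> A *v x \<in> S) \<Longrightarrow>
    \<exists>B. pairwise orthogonal B \<and> (\<forall>v\<in>B. norm v = 1 \<and> (\<exists>c. A *v v = c *\<^sub>R v)) \<and> span B = S"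
proof (induction "dim S" arbitrary: S rule: less_induct)
  case less
  show ?case
  proof (cases "S = {0}")
    case True
    then show ?thesis by (intro exI[of _ "{}"]) auto
  next
    case False
    obtain v c where v: "v \<in> S" "norm v = 1" "A *v v = c *\<^sub>R v"
      using symmetric_matrix_eigenvector_in_subspace[OF sym less.prems False] by blast
    have vv: "v \<bullet> v = 1" using v(2) by (simp add: norm_eq_1)
    define S' where "S' = S \<inter> {x. v \<bullet> x = 0}"
    have S': "subspace S'"
      unfolding S'_def by (intro subspace_inter less.prems subspace_hyperplane)
    have inv': "A *v x \<in> S'" if "x \<in> S'" for x
      using that less.prems(2) symmetric_matrix_inner[OF sym, of v x] by (simp add: S'_def v(3))
    have "v \<notin> S'" using vv by (simp add: S'_def)
    then have "S' \<subset> S" using v(1) unfolding S'_def by blast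
    then have "dim S' < dim S"
      using S' less.prems(1) by (intro dim_psubset) (simp add: span_eq_iff[THEN iffD2])
    from less.hyps[OF this S' inv'] obtain B where B: "pairwise orthogonal B"
      "\<forall>w\<in>B. norm w = 1 \<and> (\<exists>c. A *v w = c *\<^sub>R w)" "span B = S'" by blast
    have BS: "B \<subseteq> S'" using B(3) span_superset by blast
    have "pairwise orthogonal (insert v B)"
      using B(1) BS by (auto simp: pairwise_insert orthogonal_def S'_def inner_commute)
    moreover have "span (insert v B) = S"
    proof
      show "span (insert v B) \<subseteq> S"
        using BS v(1) by (intro span_minimal less.prems) (auto simp: S'_def)
      show "S \<subseteq> span (insert v B)"
      proof
        fix x assume "x \<in> S"
        then have "x - (v \<bullet> x) *\<^sub>R v \<in> S'"
          using v(1) less.prems(1)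
          by (auto simp: S'_def inner_diff_right vv intro: subspace_diff subspace_scale)
        then show "x \<in> span (insert v B)" using B(3) by (auto simp: span_insert)
      qed
    qed
    ultimately show ?thesis using B(2) v by (intro exI[of _ "insert v B"]) auto
  qed
qed

definition diagonal_matrix :: "real^'n \<Rightarrow> real^'n^'n" where
  "diagonal_matrix l = (\<chi> i j. if i = j then l $ i else 0)"

lemma diagonal_matrix_mult_vec [simp]: "diagonal_matrix l *v x = (\<chi> i. l $ i * x $ i)"
  by (simp add: diagonal_matrix_def matrix_vector_mult_def vec_eq_iff if_distrib[where f = "\<lambda>a. a * _"]
      cong: if_cong)

lemma det_diagonal_matrix [simp]: "det (diagonal_matrix l) = (\<Prod>i\<in>UNIV. l $ i)"
  by (subst det_diagonal) (auto simp: diagonal_matrix_def)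

lemma transpose_diagonal_matrix [simp]: "transpose (diagonal_matrix l) = diagonal_matrix l"
  by (auto simp: transpose_def diagonal_matrix_def vec_eq_iff)

lemma diagonal_matrix_mult: "diagonal_matrix l ** diagonal_matrix k = diagonal_matrix (\<chi> i. l $ i * k $ i)"
  unfolding matrix_eq by (simp add: matrix_vector_mul_assoc[symmetric] vec_eq_iff mult.assoc)

lemma orthogonal_matrix_cancel:
  fixes Q :: "real^'n^'n"
  assumes "orthogonal_matrix Q"
  shows "transpose Q ** Q = mat 1" "Q ** transpose Q = mat 1"
    "transpose Q ** (Q ** A) = A" "Q ** (transpose Q ** A) = A"
    "Q *v (transpose Q *v x) = x"  "transpose Q *v (Q *v x) = x"
  using assms unfolding orthogonal_matrix_def 
  by (simp_all add: matrix_mul_assoc matrix_vector_mul_assoc del: transpose_matrix_vector)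

lemma symmetric_matrix_diagonalization:
  fixes A :: "real^'n^'n"
  assumes sym: "transpose A = A"
  obtains Q l where "orthogonal_matrix Q" "A = transpose Q ** diagonal_matrix l ** Q"
proof -
  obtain B where B: "pairwise orthogonal B" "\<And>v. v \<in> B \<Longrightarrow> norm v = 1"
    "\<And>v. v \<in> B \<Longrightarrow> \<exists>c. A *v v = c *\<^sub>R v" "span B = UNIV"
    using symmetric_matrix_eigenbasis_subspace[OF sym, of UNIV] by auto
  have "0 \<notin> B" using B(2) by force
  with B(1) have ind: "independent B" by (rule pairwise_orthogonal_independent)
  then have "finite B" "card B = CARD('n)"
    using B(4) independent_bound[OF ind] dim_span_eq_card_independent[OF ind] by (auto simp: dim_UNIV)
  then obtain b :: "'n \<Rightarrow> real^'n" where b: "bij_betw b UNIV B"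
    using finite_same_card_bij[of "UNIV :: 'n set" B] by auto
  have bB: "b i \<in> B" for i using b by (auto simp: bij_betw_def)
  have bne: "b i \<noteq> b j" if "i \<noteq> j" for i j using b that by (auto simp: bij_betw_def inj_on_def)
  from B(3)[OF bB] obtain l where l: "\<And>i. A *v b i = l i *\<^sub>R b i" by metis
  define Q :: "real^'n^'n" where "Q = (\<chi> i. b i)"
  have Q: "orthogonal_matrix Q"
    unfolding orthogonal_matrix_orthonormal_rows
    using B(1,2) bB bne by (auto simp: Q_def row_def pairwise_def)
  define L where "L = diagonal_matrix (\<chi> i. l i)"
  have "(Q ** A) $ i $ j = (L ** Q) $ i $ j" for i j
  proof -
    have "(A ** transpose Q) $ j $ i = (A *v b i) $ j"
      by (simp add: matrix_matrix_mult_def matrix_vector_mult_def transpose_def Q_def)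
    also have "\<dots> = l i * b i $ j" by (simp add: l)
    also have "\<dots> = (L ** Q) $ i $ j"
      by (simp add: L_def diagonal_matrix_def matrix_matrix_mult_def Q_def
          if_distrib[where f = "\<lambda>a. a * _"] cong: if_cong)
    finally have "transpose (Q ** A) $ j $ i = (L ** Q) $ i $ j"
      by (simp add: matrix_transpose_mul sym)
    then show ?thesis by (simp add: transpose_def)
  qed
  then have "Q ** A = L ** Q" by (simp add: vec_eq_iff)
  then have "A = transpose Q ** L ** Q"
    using orthogonal_matrix_cancel(3)[OF Q, of A] by (simp add: matrix_mul_assoc)
  with Q that show ?thesis unfolding L_def by blast
qed

section \<open>Positive definite matrices and characteristic polynomials\<close>

lemma pos_def_matrix_diagonalization:
  fixes A :: "real^'n^'n"
  assumes "pos_def_matrix A"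
  obtains Q l where "orthogonal_matrix Q" "\<And>i. 0 < l $ i" "A = transpose Q ** diagonal_matrix l ** Q"
proof -
  have "transpose A = A" and pos: "x \<noteq> 0 \<Longrightarrow> 0 < x \<bullet> (A *v x)" for x
    using assms by (auto simp: pos_def_matrix_def)
  then obtain Q l where Q: "orthogonal_matrix Q" and A: "A = transpose Q ** diagonal_matrix l ** Q"
    using symmetric_matrix_diagonalization by blast
  have "0 < l $ i" for i
  proof -
    define v where "v = transpose Q *v axis i 1"
    have Qv: "Q *v v = axis i 1" unfolding v_def by (rule orthogonal_matrix_cancel(5)[OF Q])
    then have "v \<noteq> 0" by (auto simp: axis_eq_0_iff)
    then have "0 < v \<bullet> (A *v v)" by (rule pos)
    also have "\<dots> = (Q *v v) \<bullet> (diagonal_matrix l *v (Q *v v))"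
      unfolding A by (metis dot_lmul_matrix matrix_vector_mul_assoc vector_transpose_matrix transpose_transpose)
    also have "\<dots> = l $ i"
      by (simp add: Qv inner_axis')
    finally show ?thesis .
  qed
  with Q A that show ?thesis by blast
qed

lemma det_orthogonal_conj:
  fixes Q :: "real^'n^'n"
  assumes "orthogonal_matrix Q"
  shows "det (transpose Q ** A ** Q) = det A"
proof -
  have "det (transpose Q) * det Q = 1"
    using orthogonal_matrix_cancel(1)[OF assms] by (metis det_I det_mul)
  then show ?thesis by (simp add: det_mul mult.commute mult.left_commute)
qed

lemma det_pos_def_matrix: "pos_def_matrix (A :: real^'n^'n) \<Longrightarrow> 0 < det A"
  by (elim pos_def_matrix_diagonalization) (simp add: det_orthogonal_conj prod_pos)

lemma pos_def_matrix_conj_diagonal: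
  fixes Q :: "real^'n^'n"
  assumes Q: "orthogonal_matrix Q" and l: "\<And>i. 0 < l $ i"
  shows "pos_def_matrix (transpose Q ** diagonal_matrix l ** Q)"
  unfolding pos_def_matrix_def
proof (intro conjI allI impI)
  show "transpose (transpose Q ** diagonal_matrix l ** Q) = transpose Q ** diagonal_matrix l ** Q"
    by (simp add: matrix_transpose_mul matrix_mul_assoc)
  fix x :: "real^'n" assume "x \<noteq> 0"
  define y where "y = Q *v x"
  have "y \<noteq> 0"
    using \<open>x \<noteq> 0\<close> orthogonal_matrix_cancel(6)[OF Q, of x] by (metis y_def matrix_vector_mult_0_right)
  then obtain i where "y $ i \<noteq> 0" by (auto simp: vec_eq_iff)
  then have "0 < (\<Sum>i\<in>UNIV. l $ i * (y $ i * y $ i))"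
    using l by (intro sum_pos2[of _ i]) (auto simp: less_imp_le zero_less_mult_iff not_sum_squares_lt_zero linorder_neq_iff)
  also have "\<dots> = y \<bullet> (diagonal_matrix l *v y)"
    by (simp add: inner_vec_def mult.left_commute)
  also have "\<dots> = x \<bullet> (transpose Q ** diagonal_matrix l ** Q *v x)"
    unfolding y_def by (metis dot_lmul_matrix matrix_vector_mul_assoc vector_transpose_matrix transpose_transpose)
  finally show "0 < x \<bullet> (transpose Q ** diagonal_matrix l ** Q *v x)" .
qed

text \<open>
  If \<open>v\<close> is an eigenvector of the symmetric matrix \<open>B - C\<close> with eigenvalue \<open>r\<close>, then
  \<open>B\<^sup>2 - C\<^sup>2 = B (B - C) + (B - C) C\<close> gives
  \<open>0 = r * (v \<bullet> (B *v v) + v \<bullet> (C *v v))\<close>, where the second factor is positive. So all eigenvalues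
  of \<open>B - C\<close> vanish.\<close>

lemma pos_def_matrix_square_unique:
  fixes B C :: "real^'n^'n"
  assumes B: "pos_def_matrix B" and C: "pos_def_matrix C" and eq: "B ** B = C ** C"
  shows "B = C"
proof -
  have sym: "transpose B = B" "transpose C = C"
    and pos: "x \<noteq> 0 \<Longrightarrow> 0 < x \<bullet> (B *v x)" "x \<noteq> 0 \<Longrightarrow> 0 < x \<bullet> (C *v x)" for x
    using B C by (auto simp: pos_def_matrix_def)
  have "transpose (B - C) = B - C" using sym by (simp add: transpose_def vec_eq_iff)
  then obtain Q l where Q: "orthogonal_matrix Q" and D: "B - C = transpose Q ** diagonal_matrix l ** Q"
    using symmetric_matrix_diagonalization by blast
  have "l $ i = 0" for i
  proof -
    define v where "v = transpose Q *v axis i 1"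
    have Qv: "Q *v v = axis i 1" unfolding v_def by (rule orthogonal_matrix_cancel(5)[OF Q])
    then have v: "v \<noteq> 0" by (auto simp: axis_eq_0_iff)
    have "(B - C) *v v = transpose Q *v (diagonal_matrix l *v (Q *v v))"
      unfolding D by (simp only: matrix_vector_mul_assoc matrix_mul_assoc)
    also have "diagonal_matrix l *v (Q *v v) = l $ i *\<^sub>R axis i 1"
      by (simp add: Qv axis_def vec_eq_iff)
    finally have eig: "B *v v - C *v v = l $ i *\<^sub>R v"
      by (simp add: matrix_vector_mult_scaleR v_def matrix_vector_mult_diff_rdistrib del: transpose_matrix_vector)
    have "B *v (B *v v) = C *v (C *v v)" by (simp add: matrix_vector_mul_assoc eq)
    then have "v \<bullet> (B *v (B *v v - C *v v)) + v \<bullet> (B *v (C *v v)) - v \<bullet> (C *v (C *v v)) = 0"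
      by (simp add: matrix_vector_mult_diff_distrib inner_diff_right)
    moreover have "v \<bullet> (B *v (C *v v)) - v \<bullet> (C *v (C *v v)) = (B *v v - C *v v) \<bullet> (C *v v)"
      by (simp add: symmetric_matrix_inner sym inner_diff_left)
    ultimately have "l $ i * (v \<bullet> (B *v v) + v \<bullet> (C *v v)) = 0"
      by (simp add: eig matrix_vector_mult_scaleR distrib_left)
    with pos[OF v] show ?thesis by (simp add: add_pos_pos less_imp_neq[symmetric])
  qed
  then have "diagonal_matrix l = 0" by (simp add: diagonal_matrix_def vec_eq_iff)
  with D show ?thesis by (simp add: matrix_matrix_mult_def vec_eq_iff)
qed

text \<open>
  The definite description is justified by uniqueness; a root is found by taking square roots of
  the eigenvalues.\<close>

lemma matrix_sqrt:
  fixes A :: "real^'n^'n"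
  assumes "pos_def_matrix A"
  shows "pos_def_matrix (matrix_sqrt A)" "matrix_sqrt A ** matrix_sqrt A = A"
proof -
  obtain Q l where Q: "orthogonal_matrix Q" and l: "\<And>i. 0 < l $ i"
    and A: "A = transpose Q ** diagonal_matrix l ** Q"
    using pos_def_matrix_diagonalization[OF assms] by blast
  define D where "D = diagonal_matrix (\<chi> i. sqrt (l $ i))"
  define B where "B = transpose Q ** D ** Q"
  have "B ** B = transpose Q ** D ** (Q ** (transpose Q ** (D ** Q)))"
    by (simp add: B_def matrix_mul_assoc)
  also have "\<dots> = transpose Q ** (D ** D) ** Q"
    by (simp add: orthogonal_matrix_cancel(4)[OF Q]) (simp add: matrix_mul_assoc)
  also have "D ** D = diagonal_matrix l"
    using l by (simp add: D_def diagonal_matrix_mult less_imp_le vec_eq_iff)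
  finally have BB: "B ** B = A" by (simp add: A)
  have B: "pos_def_matrix B"
    unfolding B_def D_def by (rule pos_def_matrix_conj_diagonal[OF Q]) (simp add: l)
  have "pos_def_matrix (matrix_sqrt A) \<and> matrix_sqrt A ** matrix_sqrt A = A"
    unfolding matrix_sqrt_def
    by (rule theI[of _ B]) (use B BB pos_def_matrix_square_unique in auto)
  then show "pos_def_matrix (matrix_sqrt A)" "matrix_sqrt A ** matrix_sqrt A = A" by auto
qed

lemma matrix_inv_cancel:
  fixes A :: "real^'n^'n"
  assumes "det A \<noteq> 0"
  shows "A ** matrix_inv A = mat 1" "matrix_inv A ** A = mat 1"
proof -
  have "\<exists>B. A ** B = mat 1 \<and> B ** A = mat 1"
    using assms invertible_det_nz[of A] by (simp add: invertible_def)
  from someI_ex[OF this] show "A ** matrix_inv A = mat 1" "matrix_inv A ** A = mat 1"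
    by (simp_all add: matrix_inv_def)
qed

lemma matrix_inv_unique_left:
  fixes A B :: "real^'n^'n"
  assumes "B ** A = mat 1"
  shows "matrix_inv A = B"
proof -
  have "det B * det A = 1" using assms by (metis det_I det_mul)
  then have "det A \<noteq> 0" by auto
  then have "B = B ** (A ** matrix_inv A)" by (simp add: matrix_inv_cancel)
  then show ?thesis by (simp add: matrix_mul_assoc assms)
qed

lemma pos_def_matrix_inv:
  fixes A :: "real^'n^'n"
  assumes A: "pos_def_matrix A"
  shows "pos_def_matrix (matrix_inv A)"
proof -
  let ?R = "matrix_inv A"
  have sym: "transpose A = A" and pos: "x \<noteq> 0 \<Longrightarrow> 0 < x \<bullet> (A *v x)" for x
    using A by (auto simp: pos_def_matrix_def)
  have R: "A ** ?R = mat 1" "?R ** A = mat 1"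
    using matrix_inv_cancel[of A] det_pos_def_matrix[OF A] by auto
  have "transpose ?R ** A = mat 1"
    using arg_cong[OF R(1), of transpose] by (simp add: matrix_transpose_mul sym transpose_mat)
  then have "transpose ?R = ?R" using matrix_inv_unique_left by metis
  moreover have "0 < x \<bullet> (?R *v x)" if "x \<noteq> 0" for x
  proof -
    have x: "A *v (?R *v x) = x" by (simp add: matrix_vector_mul_assoc R)
    with that have "?R *v x \<noteq> 0" by (metis matrix_vector_mult_0_right)
    from pos[OF this] show ?thesis by (simp add: x inner_commute)
  qed
  ultimately show ?thesis by (simp add: pos_def_matrix_def)
qed

lemma orthogonal_transformation_orthogonal_matrix:
  fixes Q :: "real^'n^'n"
  assumes "orthogonal_matrix Q"
  shows "orthogonal_transformation ((*v) Q)"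
  using assms by (simp add: orthogonal_transformation_matrix)

text \<open>
  In an eigenbasis the map is a coordinatewise stretch, between two rotations.\<close>

lemma scales_lebesgue_pos_def_matrix:
  fixes S :: "real^'n^'n"
  assumes S: "pos_def_matrix S"
  shows "scales_lebesgue (\<lambda>x. t + S *v x) (det S)"
proof -
  obtain Q l where Q: "orthogonal_matrix Q" and l: "\<And>i. 0 < l $ i"
    and eq: "S = transpose Q ** diagonal_matrix l ** Q"
    using pos_def_matrix_diagonalization[OF S] by blast
  let ?D = "\<lambda>x. Q *v t + (\<chi> i. l $ i * x $ i)"
  have D: "scales_lebesgue ?D (\<Prod>i\<in>UNIV. l $ i)"
    by (rule scales_lebesgue_translation_diagonal[OF l])
  have Q1: "scales_lebesgue ((*v) Q) 1" and Q2: "scales_lebesgue ((*v) (transpose Q)) 1"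
    using Q by (auto intro!: scales_lebesgue_orthogonal orthogonal_transformation_orthogonal_matrix
        simp del: transpose_matrix_vector)
  have "scales_lebesgue (\<lambda>x. transpose Q *v ?D (Q *v x)) (1 * ((\<Prod>i\<in>UNIV. l $ i) * 1))"
    by (rule scales_lebesgue_comp[OF Q2 scales_lebesgue_comp[OF D Q1]])
  moreover have "transpose Q *v ?D (Q *v x) = t + S *v x" for x
  proof -
    have "transpose Q *v ?D (Q *v x) = transpose Q *v (Q *v t) + transpose Q *v (diagonal_matrix l *v (Q *v x))"
      by (simp only: diagonal_matrix_mult_vec matrix_vector_right_distrib)
    also have "\<dots> = t + S *v x"
      by (simp only: orthogonal_matrix_cancel(6)[OF Q] eq) (simp only: matrix_vector_mul_assoc matrix_mul_assoc)
    finally show ?thesis .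
  qed
  ultimately show ?thesis by (simp add: eq det_orthogonal_conj[OF Q])
qed

lemma char_polynomial_similar:
  fixes A B P :: "real^'n^'n"
  assumes P: "det P \<noteq> 0" and eq: "P ** A = B ** P"
  shows "char_polynomial A = char_polynomial B"
proof -
  have "poly (char_polynomial A) x = poly (char_polynomial B) x" for x
  proof -
    have "P ** (mat x - A) = (mat x - B) ** P"
    proof -
      have "(P ** (mat x - A)) *v v = ((mat x - B) ** P) *v v" for v
      proof -
        have mat: "(mat x - C) *v w = x *\<^sub>R w - C *v w" for C :: "real^'n^'n" and w
          by (simp add: vec_eq_iff matrix_vector_mult_def mat_def left_diff_distrib sum_subtractf
              if_distrib[where f = "\<lambda>a. a * _"] cong: if_cong)
        have "P *v (A *v v) = B *v (P *v v)" by (simp add: matrix_vector_mul_assoc eq)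
        then show ?thesis
          by (simp add: matrix_vector_mul_assoc[symmetric] mat matrix_vector_mult_diff_distrib
              matrix_vector_mult_scaleR)
      qed
      then show ?thesis by (simp add: matrix_eq)
    qed
    then have "det P * det (mat x - A) = det (mat x - B) * det P" by (metis det_mul)
    with P show ?thesis by (simp add: poly_char_polynomial)
  qed
  then show ?thesis by (simp add: poly_eq_poly_eq_iff[symmetric] fun_eq_iff)
qed

lemma proots_char_polynomial_diagonal_matrix:
  "proots (char_polynomial (diagonal_matrix l)) = image_mset (\<lambda>i. l $ i) (mset_set UNIV)"
proof -
  have "poly (char_polynomial (diagonal_matrix l)) x = poly (\<Prod>i\<in>UNIV. [:- l $ i, 1:]) x" for x
  proof -
    have "mat x - diagonal_matrix l = diagonal_matrix (\<chi> i. x - l $ i)"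
      by (simp add: vec_eq_iff mat_def diagonal_matrix_def)
    then show ?thesis by (simp add: poly_char_polynomial poly_prod)
  qed
  then have "char_polynomial (diagonal_matrix l) = (\<Prod>i\<in>UNIV. [:- l $ i, 1:])"
    by (simp add: poly_eq_poly_eq_iff[symmetric] fun_eq_iff)
  moreover have "(\<Sum>i\<in>A. {#l $ i#}) = image_mset (\<lambda>i. l $ i) (mset_set A)" if "finite A" for A
    using that by (induction A rule: finite_induct) auto
  ultimately show ?thesis by (simp add: proots_prod)
qed

section \<open>The divergence as a function of the eigenvalues\<close>

text \<open>
  The divergence between \<open>p\<close> and the density obtained from it by the change of variables that
  stretches the coordinates by the numbers \<open>sqrt (l $ i)\<close>. On vectors with positive entries this is the function of the eigenvalues
  that the theorem asks for.\<close>

definition stretch_divergence :: "(real \<Rightarrow> real) \<Rightarrow> (real^'n \<Rightarrow> real) \<Rightarrow> real^'n \<Rightarrow> ereal" where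
  "stretch_divergence f p l =
     f_divergence f p (\<lambda>x. (\<Prod>i\<in>UNIV. sqrt (l $ i)) * p (\<chi> i. sqrt (l $ i) * x $ i))"

lemma scales_lebesgue_sqrt_stretch:
  fixes l :: "real^'n"
  assumes "\<And>i. 0 < l $ i"
  shows "scales_lebesgue (\<lambda>x. \<chi> i. sqrt (l $ i) * x $ i) (\<Prod>i\<in>UNIV. sqrt (l $ i))"
  using scales_lebesgue_translation_diagonal[of "\<chi> i. sqrt (l $ i)" 0] assms by simp

lemma stretch_divergence_nonneg:
  fixes p :: "real^'n \<Rightarrow> real"
  assumes f: "convex_on {0<..} f" "f 1 = 0" and p: "prob_density p" "\<And>x. 0 < p x"
    and l: "\<And>i. 0 < l $ i"
  shows "0 \<le> stretch_divergence f p l"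
  unfolding stretch_divergence_def
proof (rule f_divergence_nonneg[OF f])
  show "prob_density (\<lambda>x. (\<Prod>i\<in>UNIV. sqrt (l $ i)) * p (\<chi> i. sqrt (l $ i) * x $ i))"
    by (rule prob_density_scales_lebesgue[OF scales_lebesgue_sqrt_stretch[OF l] p(1)])
qed (use p l in \<open>auto intro!: mult_pos_pos prod_pos\<close>)

text \<open>
  A rotation may be moved from one argument to the other, where radial symmetry absorbs it.\<close>

lemma f_divergence_pullback_orthogonal:
  fixes p q :: "real^'n \<Rightarrow> real"
  assumes f: "convex_on {0<..} f" and p: "p \<in> borel_measurable lebesgue" "\<And>x. 0 < p x"
    and q: "q \<in> borel_measurable lebesgue" "\<And>x. 0 < q x"
    and radial: "\<And>x y. norm x = norm y \<Longrightarrow> p x = p y"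
    and T: "orthogonal_transformation T"
  shows "f_divergence f p (\<lambda>x. q (T x)) = f_divergence f p q"
proof -
  have "p (T x) = p x" for x by (rule radial) (use T in \<open>simp add: orthogonal_transformation\<close>)
  then show ?thesis
    using f_divergence_scales_lebesgue[OF f scales_lebesgue_orthogonal[OF T] p(1) q(1) p(2) q(2)] by simp
qed

lemma measurable_stretch:
  fixes p :: "real^'n \<Rightarrow> real"
  assumes p: "p \<in> borel_measurable lebesgue" and l: "\<And>i. 0 < l $ i"
  shows "(\<lambda>x. c * p (\<chi> i. sqrt (l $ i) * x $ i)) \<in> borel_measurable lebesgue"
proof -
  have "(\<lambda>x. \<chi> i. sqrt (l $ i) * x $ i) \<in> lebesgue \<rightarrow>\<^sub>M lebesgue"
    using scales_lebesgue_sqrt_stretch[OF l] by (simp add: scales_lebesgue_def)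
  from measurable_compose[OF this p] show ?thesis by measurable
qed

text \<open>
  Permuting the coordinates is an orthogonal map, and \<open>p\<close> is blind to it.\<close>

lemma stretch_divergence_permute:
  fixes p :: "real^'n \<Rightarrow> real"
  assumes f: "convex_on {0<..} f" and p: "p \<in> borel_measurable lebesgue" "\<And>x. 0 < p x"
    and radial: "\<And>x y. norm x = norm y \<Longrightarrow> p x = p y"
    and l: "\<And>i. 0 < l $ i" and \<pi>: "\<pi> permutes UNIV"
  shows "stretch_divergence f p (\<chi> i. l $ \<pi> i) = stretch_divergence f p l"
proof -
  have bij: "bij \<pi>" using \<pi> by (rule permutes_bij)
  have norm_perm: "norm (\<chi> i. x $ \<pi> i) = norm x" for x :: "real^'n"
    unfolding norm_vec_def L2_set_def
    using sum.reindex_bij_betw[OF bij, of "\<lambda>i. (norm (x $ i))\<^sup>2"] by simp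
  let ?T = "\<lambda>x :: real^'n. \<chi> i. x $ \<pi> i"
  let ?c = "\<Prod>i\<in>UNIV. sqrt (l $ i)"
  have T: "orthogonal_transformation ?T"
    unfolding orthogonal_transformation
    by (auto simp: norm_perm vec_eq_iff intro!: linearI)
  have prod: "(\<Prod>i\<in>UNIV. sqrt (l $ \<pi> i)) = ?c"
    by (rule prod.reindex_bij_betw[OF bij])
  let ?q = "\<lambda>x. ?c * p (\<chi> i. sqrt (l $ \<pi> i) * x $ i)"
  have "stretch_divergence f p (\<chi> i. l $ \<pi> i) = f_divergence f p ?q"
    by (simp add: stretch_divergence_def prod)
  also have "\<dots> = f_divergence f p (\<lambda>x. ?q (?T x))"
  proof (rule f_divergence_pullback_orthogonal[OF f p _ _ radial T, symmetric])
    show "?q \<in> borel_measurable lebesgue"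
      using measurable_stretch[OF p(1), of "\<chi> i. l $ \<pi> i"] l by simp
    show "0 < ?q x" for x using p(2) l by (intro mult_pos_pos prod_pos) auto
  qed
  also have "(\<lambda>x. ?q (?T x)) = (\<lambda>x. ?c * p (\<chi> i. sqrt (l $ i) * x $ i))"
  proof
    fix x :: "real^'n"
    have "p (\<chi> i. sqrt (l $ \<pi> i) * ?T x $ i) = p (\<chi> i. sqrt (l $ i) * x $ i)"
      by (rule radial) (use norm_perm[of "\<chi> i. sqrt (l $ i) * x $ i"] in simp)
    then show "?q (?T x) = ?c * p (\<chi> i. sqrt (l $ i) * x $ i)" by simp
  qed
  finally show ?thesis by (simp add: stretch_divergence_def)
qed

lemma location_scale_density_eq:
  assumes S: "pos_def_matrix \<Sigma>"
  defines "R \<equiv> matrix_inv (matrix_sqrt \<Sigma>)"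
  shows "location_scale_density p \<mu> \<Sigma> x = det R * p (R *v (x - \<mu>))"
proof -
  let ?S = "matrix_sqrt \<Sigma>"
  have pos: "0 < det ?S" by (rule det_pos_def_matrix[OF matrix_sqrt(1)[OF S]])
  have "det R * det ?S = 1"
    unfolding R_def using matrix_inv_cancel(2)[of ?S] pos by (metis det_I det_mul less_irrefl)
  then have "det R = 1 / det ?S" using pos by (simp add: field_simps)
  moreover have "det \<Sigma> = (det ?S)\<^sup>2"
    by (metis matrix_sqrt(2)[OF S] det_mul power2_eq_square)
  then have "det \<Sigma> powr (-1/2) = 1 / det ?S"
    using pos by (simp add: powr_minus_divide powr_half_sqrt)
  ultimately show ?thesis by (simp add: location_scale_density_def R_def)
qed

text \<open>
  Undoing the location and the first scale by \<open>x = \<mu> + S1 *v y\<close> turns the first density into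
  \<open>p\<close> and the second into \<open>det A * p (A *v y)\<close> with \<open>A = R2 ** S1\<close>, where \<open>S1\<close> is the
  root of \<open>\<Sigma>1\<close> and \<open>R2\<close> the inverse root of \<open>\<Sigma>2\<close>. Since \<open>p\<close> is radial, only the Gram matrix
  \<open>M = transpose A ** A = S1 ** matrix_inv \<Sigma>2 ** S1\<close> matters. It is similar to
  \<open>\<Sigma>1 ** matrix_inv \<Sigma>2\<close> via \<open>S1\<close>, and diagonalizing it by a rotation \<open>Q\<close> replaces \<open>A\<close> by
  the stretch by the square roots of the eigenvalues.\<close>

lemma f_divergence_location_scale_eq_stretch:
  fixes p :: "real^'n \<Rightarrow> real"
  assumes f: "convex_on {0<..} f" and p: "p \<in> borel_measurable lebesgue" "\<And>x. 0 < p x"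
    and radial: "\<And>x y. norm x = norm y \<Longrightarrow> p x = p y"
    and S: "pos_def_matrix \<Sigma>1" "pos_def_matrix \<Sigma>2"
  shows "\<exists>l. (\<forall>i. 0 < l $ i) \<and> eigenvalue_listing (\<Sigma>1 ** matrix_inv \<Sigma>2) l \<and>
    (\<forall>\<mu>. f_divergence f (location_scale_density p \<mu> \<Sigma>1) (location_scale_density p \<mu> \<Sigma>2)
      = stretch_divergence f p l)"
proof -
  define S1 where "S1 = matrix_sqrt \<Sigma>1"
  define R1 where "R1 = matrix_inv S1"
  define R2 where "R2 = matrix_inv (matrix_sqrt \<Sigma>2)"
  have pd: "pos_def_matrix S1" "pos_def_matrix R1" "pos_def_matrix R2"
    using S by (simp_all add: S1_def R1_def R2_def matrix_sqrt pos_def_matrix_inv)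
  then have det: "0 < det S1" "0 < det R1" "0 < det R2"
    and sym: "transpose S1 = S1" "transpose R2 = R2"
    by (auto simp: det_pos_def_matrix pos_def_matrix_def)
  have SR: "S1 ** R1 = mat 1" using matrix_inv_cancel(1)[of S1] det by (simp add: R1_def)
  have R2R2: "R2 ** R2 = matrix_inv \<Sigma>2"
  proof (rule matrix_inv_unique_left[symmetric])
    let ?S = "matrix_sqrt \<Sigma>2"
    have "R2 ** ?S = mat 1"
      using matrix_inv_cancel(2)[of ?S] det_pos_def_matrix[OF matrix_sqrt(1)[OF S(2)]] by (simp add: R2_def)
    then have "R2 ** (R2 ** ?S) ** ?S = mat 1" by simp
    then show "R2 ** R2 ** \<Sigma>2 = mat 1"
      by (metis matrix_mul_assoc matrix_sqrt(2)[OF S(2)])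
  qed
  define A where "A = R2 ** S1"
  define M where "M = S1 ** matrix_inv \<Sigma>2 ** S1"
  have M: "M = transpose A ** A"
    by (simp add: M_def A_def matrix_transpose_mul sym R2R2[symmetric] matrix_mul_assoc)
  have detA: "0 < det A" using det by (simp add: A_def det_mul)
  have quad: "x \<bullet> (M *v x) = (norm (A *v x))\<^sup>2" for x
    unfolding M power2_norm_eq_inner
    by (metis dot_lmul_matrix matrix_vector_mul_assoc vector_transpose_matrix transpose_transpose)
  have "pos_def_matrix M"
    unfolding pos_def_matrix_def
  proof (intro conjI allI impI)
    show "transpose M = M" by (simp add: M matrix_transpose_mul)
    fix x :: "real^'n" assume "x \<noteq> 0"
    then have "A *v x \<noteq> 0"
      using matrix_inv_cancel(2)[of A] detA
      by (metis less_irrefl matrix_vector_mul_assoc matrix_vector_mul_lid matrix_vector_mult_0_right)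
    then show "0 < x \<bullet> (M *v x)" by (simp add: quad)
  qed
  then obtain Q l where Q: "orthogonal_matrix Q" and l: "\<And>i. 0 < l $ i"
    and MQ: "M = transpose Q ** diagonal_matrix l ** Q"
    using pos_def_matrix_diagonalization by blast
  have "char_polynomial M = char_polynomial (\<Sigma>1 ** matrix_inv \<Sigma>2)"
  proof (rule char_polynomial_similar[of S1])
    show "S1 ** M = \<Sigma>1 ** matrix_inv \<Sigma>2 ** S1"
      using matrix_sqrt(2)[OF S(1)] by (simp add: M_def S1_def[symmetric] matrix_mul_assoc)
  qed (use det in simp)
  moreover have "char_polynomial M = char_polynomial (diagonal_matrix l)"
  proof (rule char_polynomial_similar[of Q])
    show "Q ** M = diagonal_matrix l ** Q"
      unfolding MQ by (metis matrix_mul_assoc orthogonal_matrix_cancel(4)[OF Q])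
    have "det (transpose Q) * det Q = 1"
      using orthogonal_matrix_cancel(1)[OF Q] by (metis det_I det_mul)
    then show "det Q \<noteq> 0" by auto
  qed
  ultimately have listing: "eigenvalue_listing (\<Sigma>1 ** matrix_inv \<Sigma>2) l"
    unfolding eigenvalue_listing_def by (metis proots_char_polynomial_diagonal_matrix)
  let ?c = "\<Prod>i\<in>UNIV. sqrt (l $ i)"
  let ?D = "\<lambda>x. \<chi> i. sqrt (l $ i) * x $ i"
  have c: "0 < ?c" using l by (simp add: prod_pos)
  have "(det A)\<^sup>2 = det M" by (simp add: M det_mul power2_eq_square)
  also have "\<dots> = ?c\<^sup>2"
    using l by (simp add: MQ det_orthogonal_conj[OF Q] prod_power_distrib less_imp_le)
  finally have cA: "?c = det A" using c detA by (simp add: power2_eq_iff_nonneg less_imp_le)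
  have pA: "p (A *v x) = p (?D (Q *v x))" for x
  proof (rule radial)
    have "(norm (A *v x))\<^sup>2 = (Q *v x) \<bullet> (diagonal_matrix l *v (Q *v x))"
      unfolding quad[symmetric] MQ
      by (metis dot_lmul_matrix matrix_vector_mul_assoc vector_transpose_matrix transpose_transpose)
    also have "\<dots> = (norm (?D (Q *v x)))\<^sup>2"
      using l by (simp add: power2_norm_eq_inner inner_vec_def power_mult_distrib less_imp_le
          mult.left_commute flip: power2_eq_square)
    finally show "norm (A *v x) = norm (?D (Q *v x))" by (simp add: power2_eq_iff_nonneg)
  qed
  have "f_divergence f (location_scale_density p \<mu> \<Sigma>1) (location_scale_density p \<mu> \<Sigma>2)
      = stretch_divergence f p l" for \<mu>
  proof -
    let ?q = "\<lambda>x. ?c * p (?D x)"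
    have T: "orthogonal_transformation ((*v) Q)"
      by (rule orthogonal_transformation_orthogonal_matrix[OF Q])
    have qm: "?q \<in> borel_measurable lebesgue" by (rule measurable_stretch[OF p(1) l])
    have qpos: "0 < ?q x" for x using c p(2) by simp
    have qQm: "(\<lambda>x. ?q (Q *v x)) \<in> borel_measurable lebesgue"
      using scales_lebesgue_orthogonal[OF T]
      by (intro measurable_compose[OF _ qm]) (simp add: scales_lebesgue_def)
    have "stretch_divergence f p l = f_divergence f p (\<lambda>x. ?q (Q *v x))"
      unfolding stretch_divergence_def
      by (rule f_divergence_pullback_orthogonal[OF f p qm qpos radial T, symmetric])
    \<comment> \<open>the substitution \<open>y = R1 *v (x - \<mu>)\<close>: starting from \<open>p\<close> and its stretch, measurability is
      needed for these two only and not for the location-scale densities\<close>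
    also have "\<dots> = f_divergence f (\<lambda>x. det R1 * p (- (R1 *v \<mu>) + R1 *v x))
        (\<lambda>x. det R1 * ?q (Q *v (- (R1 *v \<mu>) + R1 *v x)))"
      by (rule f_divergence_scales_lebesgue[OF f scales_lebesgue_pos_def_matrix[OF pd(2)] p(1) qQm p(2) qpos])
    also have "(\<lambda>x. det R1 * p (- (R1 *v \<mu>) + R1 *v x)) = location_scale_density p \<mu> \<Sigma>1"
      by (simp add: fun_eq_iff location_scale_density_eq[OF S(1)] R1_def S1_def matrix_vector_mult_diff_distrib)
    also have "(\<lambda>x. det R1 * ?q (Q *v (- (R1 *v \<mu>) + R1 *v x))) = location_scale_density p \<mu> \<Sigma>2"
    proof
      fix x
      have "- (R1 *v \<mu>) + R1 *v x = R1 *v (x - \<mu>)" by (simp add: matrix_vector_mult_diff_distrib)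
      then have "det R1 * ?q (Q *v (- (R1 *v \<mu>) + R1 *v x)) = det (A ** R1) * p (A *v (R1 *v (x - \<mu>)))"
        by (simp only: pA cA det_mul mult.assoc mult.commute mult.left_commute)
      also have "A *v (R1 *v (x - \<mu>)) = (A ** R1) *v (x - \<mu>)" by (simp add: matrix_vector_mul_assoc)
      also have "A ** R1 = R2" by (simp add: A_def matrix_mul_assoc[symmetric] SR)
      finally show "det R1 * ?q (Q *v (- (R1 *v \<mu>) + R1 *v x)) = location_scale_density p \<mu> \<Sigma>2 x"
        by (simp add: location_scale_density_eq[OF S(2)] R2_def)
    qed
    finally show ?thesis ..
  qed
  with l listing show ?thesis by (intro exI[of _ l] conjI allI)
qed

theorem proposition3:
  fixes p :: "real^'n \<Rightarrow> real" and p_rad :: "real \<Rightarrow> real" and f :: "real \<Rightarrow> real"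
  assumes "prob_density p"
    and "\<And>x. 0 < p x"
    and "\<And>r. 0 \<le> r \<Longrightarrow> 0 < p_rad r"
    and "\<And>x. p x = p_rad ((norm x)\<^sup>2)"
    and "convex_on {0<..} f"
    and "f 1 = 0"
    and "strictly_convex_at {0<..} f 1"
  shows "\<exists>E :: real^'n \<Rightarrow> ereal.
           (\<forall>l. 0 \<le> E l) \<and>
           (\<forall>\<pi> l. \<pi> permutes UNIV \<longrightarrow> E (\<chi> i. l $ \<pi> i) = E l) \<and>
           (\<forall>\<mu> \<Sigma>1 \<Sigma>2. pos_def_matrix \<Sigma>1 \<longrightarrow> pos_def_matrix \<Sigma>2 \<longrightarrow>
              (\<exists>l. eigenvalue_listing (\<Sigma>1 ** matrix_inv \<Sigma>2) l) \<and>
              (\<forall>l. eigenvalue_listing (\<Sigma>1 ** matrix_inv \<Sigma>2) l \<longrightarrow>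
                 f_divergence f (location_scale_density p \<mu> \<Sigma>1) (location_scale_density p \<mu> \<Sigma>2)
                   = E l))"
proof -
  have pm: "p \<in> borel_measurable lebesgue" using assms(1) by (simp add: prob_density_def)
  have radial: "p x = p y" if "norm x = norm y" for x y using that assms(4) by metis
  \<comment> \<open>the value \<open>0\<close> is a filler: eigenvalue vectors that occur here have positive entries\<close>
  define E where "E l = (if \<forall>i. 0 < l $ i then stretch_divergence f p l else 0)" for l
  have perm: "E (\<chi> i. l $ \<pi> i) = E l" if \<pi>: "\<pi> permutes UNIV" for \<pi> l
  proof -
    have "(\<forall>i. 0 < l $ \<pi> i) \<longleftrightarrow> (\<forall>i. 0 < l $ i)"
      using permutes_surj[OF \<pi>] by (metis surjD)
    then show ?thesis
      using stretch_divergence_permute[OF assms(5) pm assms(2) radial _ \<pi>, of l] by (simp add: E_def)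
  qed
  have main: "(\<exists>l. eigenvalue_listing (\<Sigma>1 ** matrix_inv \<Sigma>2) l) \<and>
      (\<forall>l. eigenvalue_listing (\<Sigma>1 ** matrix_inv \<Sigma>2) l \<longrightarrow>
        f_divergence f (location_scale_density p \<mu> \<Sigma>1) (location_scale_density p \<mu> \<Sigma>2) = E l)"
    if S: "pos_def_matrix \<Sigma>1" "pos_def_matrix \<Sigma>2" for \<mu> \<Sigma>1 \<Sigma>2
  proof -
    have "\<exists>l. (\<forall>i. 0 < l $ i) \<and> eigenvalue_listing (\<Sigma>1 ** matrix_inv \<Sigma>2) l \<and>
      (\<forall>\<mu>. f_divergence f (location_scale_density p \<mu> \<Sigma>1) (location_scale_density p \<mu> \<Sigma>2)
        = stretch_divergence f p l)"
      by (rule f_divergence_location_scale_eq_stretch[OF assms(5) pm assms(2) radial S])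
    then obtain l where l: "\<forall>i. 0 < l $ i" and listing: "eigenvalue_listing (\<Sigma>1 ** matrix_inv \<Sigma>2) l"
      and eq: "\<forall>\<mu>. f_divergence f (location_scale_density p \<mu> \<Sigma>1)
        (location_scale_density p \<mu> \<Sigma>2) = stretch_divergence f p l"
      by (elim exE conjE)
    have "E k = E l" if "eigenvalue_listing (\<Sigma>1 ** matrix_inv \<Sigma>2) k" for k
    proof -
      have "image_mset (\<lambda>i. k $ i) (mset_set UNIV) = image_mset (\<lambda>i. l $ i) (mset_set UNIV)"
        using that listing by (simp add: eigenvalue_listing_def)
      then obtain \<pi> where \<pi>: "\<pi> permutes UNIV" and k: "\<forall>i\<in>UNIV. k $ i = l $ \<pi> i"
        using image_mset_eq_implies_permutes[of "UNIV :: 'n set" "\<lambda>i. k $ i" "\<lambda>i. l $ i"] by auto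
      have "k = (\<chi> i. l $ \<pi> i)" using k by (simp add: vec_eq_iff)
      then show ?thesis using perm[OF \<pi>, of l] by simp
    qed
    moreover have "E l = stretch_divergence f p l" using l by (simp add: E_def)
    ultimately show ?thesis using listing eq by metis
  qed
  have "0 \<le> E l" for l
    using stretch_divergence_nonneg[OF assms(5,6,1,2), of l] by (simp add: E_def)
  with perm main show ?thesis by (intro exI[of _ E] conjI allI impI) auto
qed

end
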